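(* Let $\mathfrak F=(X,R,E)$ be a descriptive $\mathbf{MGrz}$-frame. For every clopen $U\subseteq X$ and every $x\in U$, we have $Q[x]\cap\mathbf{smax}_R U\neq\varnothing$.
   Context: An $\mathbf{MK}$-frame is $(X,R,E)$, $X\neq\varnothing$, $R\subseteq X^2$, $E$ an equivalence relation, with $x\mathrel Ey$, $y\mathrel Rz$ implying $x\mathrel Ru$, $u\mathrel Ez$ for some $u$. A descriptive $\mathbf{MGrz}$-frame is an $\mathbf{MK}$-frame where $X$ is a Stone space, $R$ and $E$ are continuous (successor sets of points are closed; predecessor sets of clopens are clopen), and the algebra of clopens with $\Diamond U=R^{-1}[U]$, $\exists U=E[U]$ validates all theorems of $\mathbf{MGrz}$ (the least monadic extension of $\mathbf{Grz}=\mathbf{S4}+\Box(\Box(p\to\Box p)\to p)\to p$ with $\mathbf{S5}$ axioms for $\exists$ and $\exists\Diamond p\to\Diamond\exists p$). $Q=E\circ R$: $x\mathrel Qy$ iff $x\mathrel Rz$, $z\mathrel Ey$ for some $z$; $Q[x]=\{y:x\mathrel Qy\}$. $\mathbf{max}_R U=\{x\in U: \forall y\in U\,(x\mathrel Ry\Rightarrow y=x)\}$; $\mathbf{smax}_R U=\{x\in\mathbf{max}_RU:\forall y\in U\,(x\mathrel Qy\Rightarrow x\mathrel Ey)\}$. *)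

theory Defs
  imports "HOL-Analysis.Analysis"
begin

section \<open>The logic MGrz\<close>

datatype fm = Var nat | Bot | Imp fm fm | Dia fm | Ex fm

abbreviation Neg :: "fm \<Rightarrow> fm" where "Neg p \<equiv> Imp p Bot"
abbreviation Conj :: "fm \<Rightarrow> fm \<Rightarrow> fm" where "Conj p q \<equiv> Neg (Imp p (Neg q))"
abbreviation Iff :: "fm \<Rightarrow> fm \<Rightarrow> fm" where "Iff p q \<equiv> Conj (Imp p q) (Imp q p)"
abbreviation Box :: "fm \<Rightarrow> fm" where "Box p \<equiv> Neg (Dia (Neg p))"
abbreviation Fa :: "fm \<Rightarrow> fm" where "Fa p \<equiv> Neg (Ex (Neg p))"

text \<open>Classical truth, where variables and formulas with a modality at the root count as
  propositional atoms.\<close>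

fun ptrue :: "(fm \<Rightarrow> bool) \<Rightarrow> fm \<Rightarrow> bool" where
  "ptrue v (Var n) = v (Var n)"
| "ptrue v Bot = False"
| "ptrue v (Imp p q) = (ptrue v p \<longrightarrow> ptrue v q)"
| "ptrue v (Dia p) = v (Dia p)"
| "ptrue v (Ex p) = v (Ex p)"

definition tautology :: "fm \<Rightarrow> bool" where
  "tautology p \<longleftrightarrow> (\<forall>v. ptrue v p)"

text \<open>The axioms are schemes, so closure under uniform substitution is derivable
  (lemma \<open>MGrz_subst\<close>). As \<open>Dia\<close> and \<open>Ex\<close> are primitive, the duality axioms are needed for
  \<open>Box\<close> and \<open>Fa\<close> to be normal modalities with duals \<open>Dia\<close> and \<open>Ex\<close>.\<close>

inductive_set MGrz :: "fm set" where
  taut: "tautology p \<Longrightarrow> p \<in> MGrz"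
| K_Box: "Imp (Box (Imp p q)) (Imp (Box p) (Box q)) \<in> MGrz"
| dual_Dia: "Iff (Dia p) (Neg (Box (Neg p))) \<in> MGrz"
| T_Box: "Imp (Box p) p \<in> MGrz"
| four_Box: "Imp (Box p) (Box (Box p)) \<in> MGrz"
| grz: "Imp (Box (Imp (Box (Imp p (Box p))) p)) p \<in> MGrz"
| K_Fa: "Imp (Fa (Imp p q)) (Imp (Fa p) (Fa q)) \<in> MGrz"
| dual_Ex: "Iff (Ex p) (Neg (Fa (Neg p))) \<in> MGrz"
| T_Fa: "Imp (Fa p) p \<in> MGrz"
| four_Fa: "Imp (Fa p) (Fa (Fa p)) \<in> MGrz"
| five_Ex: "Imp (Ex p) (Fa (Ex p)) \<in> MGrz"
| Ex_Dia: "Imp (Ex (Dia p)) (Dia (Ex p)) \<in> MGrz"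
| mp: "Imp p q \<in> MGrz \<Longrightarrow> p \<in> MGrz \<Longrightarrow> q \<in> MGrz"
| nec_Box: "p \<in> MGrz \<Longrightarrow> Box p \<in> MGrz"
| nec_Fa: "p \<in> MGrz \<Longrightarrow> Fa p \<in> MGrz"

fun fsubst :: "(nat \<Rightarrow> fm) \<Rightarrow> fm \<Rightarrow> fm" where
  "fsubst s (Var n) = s n"
| "fsubst s Bot = Bot"
| "fsubst s (Imp p q) = Imp (fsubst s p) (fsubst s q)"
| "fsubst s (Dia p) = Dia (fsubst s p)"
| "fsubst s (Ex p) = Ex (fsubst s p)"

lemma ptrue_fsubst: "ptrue v (fsubst s p) = ptrue (\<lambda>q. ptrue v (fsubst s q)) p"
  by (induction p) auto

lemma MGrz_subst: "p \<in> MGrz \<Longrightarrow> fsubst s p \<in> MGrz"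
proof (induction rule: MGrz.induct)
  case (taut p)
  then show ?case
    by (simp add: MGrz.taut tautology_def ptrue_fsubst [of _ s p])
next
  case (mp p q)
  then show ?case
    using MGrz.mp [of "fsubst s p" "fsubst s q"] by simp
qed (simp_all add: MGrz.K_Box MGrz.dual_Dia MGrz.T_Box MGrz.four_Box MGrz.grz MGrz.K_Fa
    MGrz.dual_Ex MGrz.T_Fa MGrz.four_Fa MGrz.five_Ex MGrz.Ex_Dia MGrz.nec_Box MGrz.nec_Fa)


section \<open>Descriptive frames\<close>

definition MK_frame :: "'a set \<Rightarrow> 'a rel \<Rightarrow> 'a rel \<Rightarrow> bool" where
  "MK_frame X R E \<longleftrightarrow> X \<noteq> {} \<and> R \<subseteq> X \<times> X \<and> equiv X E \<and>
     (\<forall>x y z. (x, y) \<in> E \<and> (y, z) \<in> R \<longrightarrow> (\<exists>u. (x, u) \<in> R \<and> (u, z) \<in> E))"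

definition clopenin :: "'a topology \<Rightarrow> 'a set \<Rightarrow> bool" where
  "clopenin T U \<longleftrightarrow> openin T U \<and> closedin T U"

definition Stone_space :: "'a topology \<Rightarrow> bool" where
  "Stone_space T \<longleftrightarrow> compact_space T \<and> Hausdorff_space T \<and>
     (\<forall>U x. openin T U \<and> x \<in> U \<longrightarrow> (\<exists>V. clopenin T V \<and> x \<in> V \<and> V \<subseteq> U))"

definition continuous_rel :: "'a topology \<Rightarrow> 'a rel \<Rightarrow> bool" where
  "continuous_rel T S \<longleftrightarrow> (\<forall>x\<in>topspace T. closedin T (S `` {x})) \<and>
     (\<forall>U. clopenin T U \<longrightarrow> clopenin T (S\<inverse> `` U))"

text \<open>The value of a formula in the powerset algebra of a frame on \<open>X\<close>; on a descriptive frame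
  the clopen sets form a subalgebra.\<close>

fun fval :: "'a set \<Rightarrow> 'a rel \<Rightarrow> 'a rel \<Rightarrow> (nat \<Rightarrow> 'a set) \<Rightarrow> fm \<Rightarrow> 'a set" where
  "fval X R E v (Var n) = v n"
| "fval X R E v Bot = {}"
| "fval X R E v (Imp p q) = (X - fval X R E v p) \<union> fval X R E v q"
| "fval X R E v (Dia p) = R\<inverse> `` fval X R E v p"
| "fval X R E v (Ex p) = E `` fval X R E v p"

definition clopen_valid :: "'a topology \<Rightarrow> 'a rel \<Rightarrow> 'a rel \<Rightarrow> fm \<Rightarrow> bool" where
  "clopen_valid T R E p \<longleftrightarrow>
     (\<forall>v. (\<forall>n. clopenin T (v n)) \<longrightarrow> fval (topspace T) R E v p = topspace T)"

text \<open>The underlying set of the frame is the carrier of the topology.\<close>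

definition descriptive_MGrz_frame :: "'a topology \<Rightarrow> 'a rel \<Rightarrow> 'a rel \<Rightarrow> bool" where
  "descriptive_MGrz_frame T R E \<longleftrightarrow> MK_frame (topspace T) R E \<and> Stone_space T \<and>
     continuous_rel T R \<and> continuous_rel T E \<and> (\<forall>p\<in>MGrz. clopen_valid T R E p)"

text \<open>The composition \<open>O\<close> applies its left argument first.\<close>

definition Qrel :: "'a rel \<Rightarrow> 'a rel \<Rightarrow> 'a rel" where
  "Qrel R E = R O E"

definition max_rel :: "'a rel \<Rightarrow> 'a set \<Rightarrow> 'a set" where
  "max_rel R U = {x \<in> U. \<forall>y\<in>U. (x, y) \<in> R \<longrightarrow> y = x}"

definition smax_rel :: "'a rel \<Rightarrow> 'a rel \<Rightarrow> 'a set \<Rightarrow> 'a set" where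
  "smax_rel R E U = {x \<in> max_rel R U. \<forall>y\<in>U. (x, y) \<in> Qrel R E \<longrightarrow> (x, y) \<in> E}"

end

theory Submission
  imports Defs
begin

text \<open>
  On \<open>E\<close>-saturated clopen sets the Grzegorczyk axiom for \<open>R\<close> turns into the Grzegorczyk axiom
  for the quasi-order \<open>Q\<close>. By compactness, \<open>x\<close> is \<open>Q\<close>-below a point \<open>y\<close> that is \<open>Q\<close>-quasi-maximal
  in \<open>U\<close>. If \<open>y\<close> and some \<open>z\<close> in \<open>U\<close> were \<open>Q\<close>-equivalent but not \<open>E\<close>-equivalent, a saturated
  clopen set separating them would refute Grz. Any \<open>R\<close>-maximal point of \<open>U\<close> that is \<open>R\<close>-above
  \<open>y\<close> is then the required one; such a point exists by the same argument applied to \<open>R\<close> instead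
  of \<open>Q\<close>.
\<close>

section \<open>Stone spaces: clopen separation, and quasi-maximal points by compactness\<close>

lemma clopenin_Diff: "clopenin T U \<Longrightarrow> clopenin T V \<Longrightarrow> clopenin T (U - V)"
  by (auto simp: clopenin_def)

lemma clopenin_Int: "clopenin T U \<Longrightarrow> clopenin T V \<Longrightarrow> clopenin T (U \<inter> V)"
  by (auto simp: clopenin_def)

lemma clopenin_subset: "clopenin T U \<Longrightarrow> U \<subseteq> topspace T"
  by (auto simp: clopenin_def openin_subset)

lemma Stone_space_separate_point:
  assumes "Stone_space T" "closedin T C" "z \<in> topspace T" "z \<notin> C"
  obtains V where "clopenin T V" "z \<in> V" "V \<inter> C = {}"
proof -
  have "openin T (topspace T - C)" "z \<in> topspace T - C"
    using assms by auto
  then obtain V where "clopenin T V" "z \<in> V" "V \<subseteq> topspace T - C"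
    using assms(1) unfolding Stone_space_def by meson
  then show thesis
    using that by blast
qed

text \<open>Point separation covers \<open>C\<close> by clopen sets missing \<open>D\<close>; by
  compactness finitely many suffice, and their union is still clopen.\<close>

lemma Stone_space_separate_closed:
  assumes "Stone_space T" "closedin T C" "closedin T D" "C \<inter> D = {}"
  obtains V where "clopenin T V" "C \<subseteq> V" "V \<inter> D = {}"
proof -
  define \<V> where "\<V> = {V. clopenin T V \<and> V \<inter> D = {}}"
  have "compactin T C"
    using assms by (simp add: Stone_space_def closedin_compact_space)
  moreover have "C \<subseteq> \<Union>\<V>"
  proof
    fix c assume "c \<in> C"
    then have "c \<in> topspace T" "c \<notin> D"
      using assms(2,4) closedin_subset by blast+
    then show "c \<in> \<Union>\<V>"
      using Stone_space_separate_point[OF assms(1,3)] unfolding \<V>_def by blast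
  qed
  moreover have "\<And>V. V \<in> \<V> \<Longrightarrow> openin T V"
    by (auto simp: \<V>_def clopenin_def)
  ultimately obtain \<F> where \<F>: "finite \<F>" "\<F> \<subseteq> \<V>" "C \<subseteq> \<Union>\<F>"
    using compactinD by metis
  show thesis
  proof
    show "clopenin T (\<Union>\<F>)"
      using \<F> unfolding clopenin_def \<V>_def by (blast intro: openin_Union closedin_Union)
    show "\<Union>\<F> \<inter> D = {}"
      using \<F> unfolding \<V>_def by blast
  qed (fact \<F>)
qed

text \<open>As \<open>S\<close> need not be antisymmetric, Zorn's lemma is applied to the sets
  \<open>f c\<close> of points of \<open>U\<close> not above \<open>c\<close>, which grow as
  \<open>c\<close> moves up. Compactness supplies the bounds of chains.\<close>

lemma compact_quasi_max_exists:
  assumes "compact_space T" "closedin T U" "refl_on (topspace T) S" "trans S"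
    and closed: "\<And>y. y \<in> topspace T \<Longrightarrow> closedin T (S `` {y})"
    and "x \<in> U"
  shows "\<exists>y\<in>U. (x, y) \<in> S \<and> (\<forall>z\<in>U. (y, z) \<in> S \<longrightarrow> (z, y) \<in> S)"
proof -
  define f where "f c = U - S `` {c}" for c
  define D where "D = U \<inter> S `` {x}"
  have UX: "U \<subseteq> topspace T"
    using assms(2) closedin_subset by blast
  have refl: "(c, c) \<in> S" if "c \<in> U" for c
    using that UX assms(3) by (auto simp: refl_on_def)
  have mono: "f c \<subseteq> f d" if "(c, d) \<in> S" for c d
    using that assms(4) unfolding f_def trans_def by blast
  have xD: "x \<in> D"
    using refl assms(6) by (simp add: D_def)
  have "\<exists>M\<in>f ` D. \<forall>A\<in>f ` D. M \<subseteq> A \<longrightarrow> A = M"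
  proof (rule subset_Zorn)
    fix \<C> assume ch: "subset.chain (f ` D) \<C>"
    show "\<exists>B\<in>f ` D. \<forall>A\<in>\<C>. A \<subseteq> B"
    proof (cases "\<C> = {}")
      case True
      then show ?thesis using xD by blast
    next
      case False
      \<comment> \<open>Complements in \<open>U\<close> of the chain: for \<open>A = f c\<close> the
        closed set of points of \<open>U\<close> above \<open>c\<close>. A point common to all of
        them bounds the chain.\<close>
      define K where "K = (\<lambda>A. U - A) ` \<C>"
      have K: "\<exists>c\<in>D. A = f c \<and> U - A = U \<inter> S `` {c}" if "A \<in> \<C>" for A
        using that ch unfolding subset.chain_def f_def by blast
      have "\<Inter>K \<noteq> {}"
      proof -
        have "closedin T A" if "A \<in> K" for A
          using that K closed UX assms(2) unfolding K_def D_def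
          by (metis (no_types, lifting) IntD1 closedin_Int imageE subsetD)
        moreover have "\<Inter>\<F> \<noteq> {}" if \<F>: "finite \<F>" "\<F> \<subseteq> K" for \<F>
        proof (cases "\<F> = {}")
          case False
          obtain \<G> where \<G>: "finite \<G>" "\<G> \<subseteq> \<C>" "\<F> = (\<lambda>A. U - A) ` \<G>"
            using finite_subset_image[OF \<F>[unfolded K_def]] by blast
          \<comment> \<open>A finite nonempty chain has a largest member \<open>f c\<close>; by
            reflexivity \<open>c\<close> then lies in every member of \<open>\<F>\<close>.\<close>
          then have "\<Union>\<G> \<in> \<G>"
            using ch False
            by (intro Union_in_chain[of _ "f ` D"]) (auto simp: subset_chain_def subset_iff)
          then have "\<Union>\<G> \<in> \<C>"
            using \<G>(2) by (rule subsetD[rotated])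
          from K[OF this] obtain c where "c \<in> D" "U - \<Union>\<G> = U \<inter> S `` {c}"
            by auto
          then have "c \<in> U - \<Union>\<G>"
            using refl by (auto simp: D_def)
          then show ?thesis
            using \<G>(3) by blast
        qed simp
        ultimately show ?thesis
          using assms(1)[unfolded compact_space_fip, rule_format, of K] by auto
      qed
      then obtain d where "d \<in> \<Inter>K"
        by blast
      then have d: "d \<in> U - A" if "A \<in> \<C>" for A
        using that unfolding K_def by blast
      have above: "\<exists>c\<in>D. A = f c \<and> (c, d) \<in> S" if "A \<in> \<C>" for A
        using K[OF that] d[OF that] by blast
      obtain A where "A \<in> \<C>"
        using False by blast
      then have "d \<in> D"
        using above[of A] d[of A] transD[OF assms(4)] unfolding D_def by blast
      moreover have "\<forall>A\<in>\<C>. A \<subseteq> f d"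
        using above mono by blast
      ultimately show ?thesis by blast
    qed
  qed
  then obtain y where y: "y \<in> D" "\<forall>z\<in>D. f y \<subseteq> f z \<longrightarrow> f z = f y"
    by auto
  have "(z, y) \<in> S" if "z \<in> U" "(y, z) \<in> S" for z
  proof -
    have "z \<in> D"
      using that y(1) transD[OF assms(4)] unfolding D_def by blast
    then have "f z = f y"
      using y(2) mono that(2) by blast
    \<comment> \<open>Since \<open>y\<close> is not in \<open>f y = f z\<close>, it must be above
      \<open>z\<close>.\<close>
    moreover have "y \<in> U" "y \<notin> f y"
      using y(1) refl by (auto simp: D_def f_def)
    ultimately show ?thesis
      unfolding f_def by blast
  qed
  then show ?thesis
    using y(1) unfolding D_def by blast
qed

section \<open>Topology and order of a descriptive frame\<close>

locale descriptive_MGrz =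
  fixes T :: "'a topology" and R E :: "'a rel"
  assumes frame: "descriptive_MGrz_frame T R E"
begin

lemma Stone: "Stone_space T"
  and compact: "compact_space T"
  and R_sub: "R \<subseteq> topspace T \<times> topspace T"
  and equiv_E: "equiv (topspace T) E"
  and valid: "p \<in> MGrz \<Longrightarrow> clopen_valid T R E p"
  and R_closed: "y \<in> topspace T \<Longrightarrow> closedin T (R `` {y})"
  and E_closed: "y \<in> topspace T \<Longrightarrow> closedin T (E `` {y})"
  using frame
  by (auto simp: descriptive_MGrz_frame_def Stone_space_def MK_frame_def continuous_rel_def)

lemma fval_valid:
  assumes "p \<in> MGrz" "clopenin T V"
  shows "fval (topspace T) R E (\<lambda>_. V) p = topspace T"
  using valid[OF assms(1)] assms(2) by (simp add: clopen_valid_def)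

lemma E_commutes: "(x, y) \<in> E \<Longrightarrow> (y, z) \<in> R \<Longrightarrow> \<exists>u. (x, u) \<in> R \<and> (u, z) \<in> E"
  using frame unfolding descriptive_MGrz_frame_def MK_frame_def by blast

lemma E_refl: "x \<in> topspace T \<Longrightarrow> (x, x) \<in> E"
  using equiv_E by (auto simp: equiv_def refl_on_def)

lemma E_sym: "(x, y) \<in> E \<Longrightarrow> (y, x) \<in> E"
  using equiv_E by (meson equivE symD)

lemma E_trans: "(x, y) \<in> E \<Longrightarrow> (y, z) \<in> E \<Longrightarrow> (x, z) \<in> E"
  using equiv_E by (meson equivE transD)

lemma E_topspace: "(x, y) \<in> E \<Longrightarrow> y \<in> topspace T"
  using equiv_E by (auto simp: equiv_def)

lemma E_clopen:
  assumes "clopenin T V"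
  shows "clopenin T (E `` V)"
proof -
  have "E\<inverse> = E"
    using E_sym by auto
  then show ?thesis
    using assms frame unfolding descriptive_MGrz_frame_def continuous_rel_def by metis
qed

text \<open>Continuity controls only images of clopen sets. For \<open>z\<close> outside the image,
  the closed class of \<open>z\<close> is disjoint from \<open>C\<close>; a clopen \<open>V\<close>
  separating them has a clopen saturation that still misses \<open>z\<close>.\<close>

lemma closedin_E_image:
  assumes "closedin T C"
  shows "closedin T (E `` C)"
proof -
  have "\<exists>W. openin T W \<and> z \<in> W \<and> W \<subseteq> topspace T - E `` C" if z: "z \<in> topspace T - E `` C" for z
  proof -
    have "C \<inter> E `` {z} = {}"
      using z E_sym by blast
    then obtain V where V: "clopenin T V" "C \<subseteq> V" "V \<inter> E `` {z} = {}"
      using Stone_space_separate_closed[OF Stone assms E_closed] z by blast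
    have "openin T (topspace T - E `` V)"
      using E_clopen[OF V(1)] by (auto simp: clopenin_def)
    moreover have "z \<in> topspace T - E `` V"
      using V(3) z E_sym by blast
    ultimately show ?thesis
      using V(2) by blast
  qed
  then have "openin T (topspace T - E `` C)"
    by (subst openin_subopen) blast
  moreover have "E `` C \<subseteq> topspace T"
    using E_topspace by blast
  ultimately show ?thesis
    by (simp add: closedin_def)
qed

text \<open>Validity is known only for clopen valuations, but successor sets are closed: a clopen
  \<open>V\<close> around \<open>x\<close> missing them would make axiom T fail at \<open>x\<close>
  for the complement of \<open>V\<close>.\<close>

lemma refl_on_R: "refl_on (topspace T) R"
proof -
  have "(x, x) \<in> R" if x: "x \<in> topspace T" for x
  proof (rule ccontr)
    assume "(x, x) \<notin> R"
    then obtain V where V: "clopenin T V" "x \<in> V" "V \<inter> R `` {x} = {}"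
      using Stone_space_separate_point[OF Stone R_closed[OF x] x] by blast
    have "fval (topspace T) R E (\<lambda>_. V) (Imp (Box (Neg (Var 0))) (Neg (Var 0))) = topspace T"
      by (intro fval_valid MGrz.T_Box V(1))
    then have "x \<in> fval (topspace T) R E (\<lambda>_. V) (Imp (Box (Neg (Var 0))) (Neg (Var 0)))"
      using x by simp
    then show False
      using V x by auto
  qed
  then show ?thesis
    using R_sub by (auto simp: refl_on_def)
qed

text \<open>With \<open>V\<close> around \<open>z\<close> missing the successors of
  \<open>x\<close>, the box of the complement of \<open>V\<close> holds at \<open>x\<close> but not
  at \<open>y\<close>, against axiom 4.\<close>

lemma trans_R: "trans R"
proof (rule transI, rule ccontr)
  fix x y z assume a: "(x, y) \<in> R" "(y, z) \<in> R" "(x, z) \<notin> R"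
  then have X: "x \<in> topspace T" "y \<in> topspace T" "z \<in> topspace T"
    using R_sub by auto
  obtain V where V: "clopenin T V" "z \<in> V" "V \<inter> R `` {x} = {}"
    using Stone_space_separate_point[OF Stone R_closed[OF X(1)] X(3)] a(3) by blast
  let ?p = "Neg (Var 0)"
  have "fval (topspace T) R E (\<lambda>_. V) (Imp (Box ?p) (Box (Box ?p))) = topspace T"
    by (intro fval_valid MGrz.four_Box V(1))
  then have "x \<in> fval (topspace T) R E (\<lambda>_. V) (Imp (Box ?p) (Box (Box ?p)))"
    using X by simp
  then show False
    using V X a clopenin_subset[OF V(1)] by auto
qed

text \<open>The Grzegorczyk axiom for the negation of \<open>W\<close>, read contrapositively.\<close>

lemma Grz_clopen:
  assumes "clopenin T W" "y \<in> W"
  obtains w where "(y, w) \<in> R" "w \<in> W"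
    "\<And>a b. (w, a) \<in> R \<Longrightarrow> (a, b) \<in> R \<Longrightarrow> b \<in> W \<Longrightarrow> a \<in> W"
proof -
  let ?p = "Neg (Var 0)"
  let ?g = "Imp (Box (Imp (Box (Imp ?p (Box ?p))) ?p)) ?p"
  have X: "W \<subseteq> topspace T" "y \<in> topspace T"
    using assms clopenin_subset by blast+
  \<comment> \<open>For \<open>p\<close> the complement of \<open>W\<close>, this is where
    \<open>p\<close> implies \<open>Box p\<close> fails. Points of \<open>W\<close> that see no
    point of \<open>?B\<close> are those where the premise of Grz's inner implication holds and
    \<open>p\<close> fails.\<close>
  let ?B = "(topspace T - W) \<inter> R\<inverse> `` W"
  have fval_p: "topspace T - (topspace T - W) = W"
    using X(1) by blast
  have fval_neg: "topspace T - (W \<union> (topspace T - R\<inverse> `` W)) = ?B"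
    by blast
  have fval_box: "topspace T - (topspace T - (topspace T - R\<inverse> `` ?B) \<union> (topspace T - W))
      = W - R\<inverse> `` ?B"
    using X(1) by blast
  have "fval (topspace T) R E (\<lambda>_. W) ?g = topspace T"
    by (intro fval_valid MGrz.grz assms(1))
  then have "y \<in> fval (topspace T) R E (\<lambda>_. W) ?g"
    using X(2) by simp
  then have "y \<in> topspace T - (topspace T - R\<inverse> `` (W - R\<inverse> `` ?B)) \<union> (topspace T - W)"
    by (simp only: fval.simps Un_empty_right fval_p fval_neg fval_box)
  then have "y \<in> R\<inverse> `` (W - R\<inverse> `` ?B)"
    using assms(2) by blast
  then obtain w where "(y, w) \<in> R" "w \<in> W" "w \<notin> R\<inverse> `` ?B"
    by blast
  then show thesis
    using that R_sub by blast
qed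

text \<open>Compactness gives a quasi-maximal point; Grz rules out a second point of
  \<open>U\<close> that is \<open>R\<close>-equivalent to it.\<close>

lemma max_rel_exists:
  assumes "clopenin T U" "x \<in> U"
  obtains y where "(x, y) \<in> R" "y \<in> max_rel R U"
proof -
  obtain y where y: "y \<in> U" "(x, y) \<in> R" "\<And>z. z \<in> U \<Longrightarrow> (y, z) \<in> R \<Longrightarrow> (z, y) \<in> R"
    using compact_quasi_max_exists[OF compact _ refl_on_R trans_R R_closed assms(2)] assms(1)
    unfolding clopenin_def by blast
  have "z = y" if z: "z \<in> U" "(y, z) \<in> R" for z
  proof (rule ccontr)
    assume "z \<noteq> y"
    have X: "y \<in> topspace T" "z \<in> topspace T"
      using z R_sub by auto
    have "closedin T {z}"
      using X Stone by (simp add: Stone_space_def closedin_Hausdorff_singleton)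
    then obtain V where V: "clopenin T V" "y \<in> V" "V \<inter> {z} = {}"
      using Stone_space_separate_point[OF Stone _ X(1)] \<open>z \<noteq> y\<close> by blast
    obtain w where w: "(y, w) \<in> R" "w \<in> U \<inter> V"
      "\<And>a b. (w, a) \<in> R \<Longrightarrow> (a, b) \<in> R \<Longrightarrow> b \<in> U \<inter> V \<Longrightarrow> a \<in> U \<inter> V"
      using Grz_clopen[OF clopenin_Int[OF assms(1) V(1)]] y(1) V(2) by blast
    \<comment> \<open>As \<open>w\<close> is in \<open>U\<close> and above \<open>y\<close>,
      quasi-maximality leads from \<open>w\<close> back to \<open>y\<close> and on to
      \<open>z\<close>. So \<open>z\<close> lies between \<open>w\<close> and \<open>y\<close>, both
      in \<open>V\<close>.\<close>
    have "(w, z) \<in> R"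
      using w y(3) z(2) trans_R unfolding trans_def by blast
    then have "z \<in> V"
      using w(3) y z V(2) by blast
    then show False
      using V(3) by blast
  qed
  then show thesis
    using that y unfolding max_rel_def by blast
qed

section \<open>The quasi-order \<open>Q\<close> and Grz modulo \<open>E\<close>\<close>

abbreviation Q :: "'a rel" where "Q \<equiv> Qrel R E"

lemma Q_iff: "(x, y) \<in> Q \<longleftrightarrow> (\<exists>z. (x, z) \<in> R \<and> (z, y) \<in> E)"
  by (auto simp: Qrel_def)

text \<open>The commutation condition lets \<open>Q\<close> absorb \<open>E\<close> on the left;
  this is what makes \<open>Q\<close> transitive.\<close>

lemma E_Q:
  assumes "(x, y) \<in> E" "(y, z) \<in> Q"
  shows "(x, z) \<in> Q"
proof -
  obtain u where "(y, u) \<in> R" "(u, z) \<in> E"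
    using assms(2) by (auto simp: Q_iff)
  then show ?thesis
    using E_commutes[OF assms(1), of u] E_trans[of _ u z] by (auto simp: Q_iff)
qed

lemma Q_E: "(x, y) \<in> Q \<Longrightarrow> (y, z) \<in> E \<Longrightarrow> (x, z) \<in> Q"
  unfolding Q_iff using E_trans by meson

lemma R_Q: "(x, y) \<in> R \<Longrightarrow> (y, z) \<in> Q \<Longrightarrow> (x, z) \<in> Q"
  unfolding Q_iff using transD[OF trans_R] by meson

lemma R_imp_Q: "(x, y) \<in> R \<Longrightarrow> (x, y) \<in> Q"
  unfolding Q_iff using E_refl R_sub by (meson mem_Sigma_iff subsetD)

lemma trans_Q: "trans Q"
proof (rule transI)
  fix x y z assume yz: "(x, y) \<in> Q" "(y, z) \<in> Q"
  from yz(1) obtain u where "(x, u) \<in> R" "(u, y) \<in> E"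
    by (auto simp: Q_iff)
  then show "(x, z) \<in> Q"
    by (rule R_Q[OF _ E_Q[OF _ yz(2)]])
qed

lemma refl_on_Q: "refl_on (topspace T) Q"
  using refl_on_R R_imp_Q unfolding refl_on_def by metis

lemma Q_closed: "y \<in> topspace T \<Longrightarrow> closedin T (Q `` {y})"
  using closedin_E_image[OF R_closed] by (simp add: Qrel_def relcomp_Image)

text \<open>Two successive \<open>Q\<close>-steps can be replaced by \<open>R\<close>-steps through
  \<open>E\<close>-equivalent points, and membership in a saturated \<open>W\<close> does not change
  along \<open>E\<close>.\<close>

lemma Grz_saturated:
  assumes "clopenin T W" "y \<in> W" and sat: "E `` W \<subseteq> W"
  obtains w where "(y, w) \<in> R" "w \<in> W"
    "\<And>a b. (w, a) \<in> Q \<Longrightarrow> (a, b) \<in> Q \<Longrightarrow> b \<in> W \<Longrightarrow> a \<in> W"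
proof -
  obtain w where w: "(y, w) \<in> R" "w \<in> W"
    "\<And>a b. (w, a) \<in> R \<Longrightarrow> (a, b) \<in> R \<Longrightarrow> b \<in> W \<Longrightarrow> a \<in> W"
    by (rule Grz_clopen[OF assms(1,2)]) blast
  have *: "a \<in> W" if ab: "(w, a) \<in> Q" "(a, b) \<in> Q" "b \<in> W" for a b
  proof -
    obtain c where c: "(w, c) \<in> R" "(c, a) \<in> E"
      using ab(1) by (auto simp: Q_iff)
    obtain d where d: "(c, d) \<in> R" "(d, b) \<in> E"
      using E_Q[OF c(2) ab(2)] by (auto simp: Q_iff)
    have "d \<in> W"
      using d(2) ab(3) sat E_sym by blast
    then have "c \<in> W"
      using w(3) c(1) d(1) by blast
    then show ?thesis
      using c(2) sat by blast
  qed
  show thesis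
    by (rule that[OF w(1,2) *])
qed

text \<open>The argument of \<open>max_rel_exists\<close> modulo \<open>E\<close>, with a class in
  place of a point.\<close>

lemma Q_quasi_max_imp_E:
  assumes U: "clopenin T U" "y \<in> U"
    and qmax: "\<And>z. z \<in> U \<Longrightarrow> (y, z) \<in> Q \<Longrightarrow> (z, y) \<in> Q"
    and z: "z \<in> U" "(y, z) \<in> Q"
  shows "(y, z) \<in> E"
proof (rule ccontr)
  assume "(y, z) \<notin> E"
  have X: "y \<in> topspace T" "z \<in> topspace T"
    using U z(1) clopenin_subset by blast+
  obtain V where V: "clopenin T V" "z \<in> V" "V \<inter> E `` {y} = {}"
    using Stone_space_separate_point[OF Stone E_closed[OF X(1)] X(2)] \<open>(y, z) \<notin> E\<close> by blast
  \<comment> \<open>Saturated, contains \<open>y\<close> and omits \<open>z\<close>. Since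
    \<open>U\<close> itself may fail to be saturated, \<open>E\<close>-equivalent points of
    \<open>U\<close> stand in for points of \<open>W\<close>.\<close>
  define W where "W = E `` U - E `` V"
  have "clopenin T W"
    unfolding W_def by (intro clopenin_Diff E_clopen U V)
  moreover have yW: "y \<in> W"
    using U(2) V(3) E_refl[OF X(1)] E_sym unfolding W_def by blast
  moreover have "E `` W \<subseteq> W"
    unfolding W_def using E_sym E_trans by blast
  ultimately obtain w where w: "(y, w) \<in> R" "w \<in> W"
    "\<And>a b. (w, a) \<in> Q \<Longrightarrow> (a, b) \<in> Q \<Longrightarrow> b \<in> W \<Longrightarrow> a \<in> W"
    by (rule Grz_saturated) blast
  obtain u where u: "u \<in> U" "(u, w) \<in> E"
    using w(2) unfolding W_def by blast
  \<comment> \<open>Quasi-maximality speaks of points of \<open>U\<close> only, so it is applied to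
    \<open>u\<close> and carried over to \<open>w\<close>.\<close>
  have "(u, y) \<in> Q"
    using qmax[OF u(1)] Q_E[OF R_imp_Q[OF w(1)] E_sym[OF u(2)]] .
  then have "(w, z) \<in> Q"
    using E_Q[OF E_sym[OF u(2)]] z(2) transD[OF trans_Q] by blast
  then have "z \<in> W"
    using w(3)[OF _ qmax[OF z] yW] by blast
  then show False
    using V(2) E_refl[OF X(2)] unfolding W_def by blast
qed

end

theorem theorem6p17:
  fixes T :: "'a topology" and R E :: "'a rel" and U :: "'a set" and x :: 'a
  assumes "descriptive_MGrz_frame T R E"
    and "clopenin T U"
    and "x \<in> U"
  shows "Qrel R E `` {x} \<inter> smax_rel R E U \<noteq> {}"
proof -
  interpret descriptive_MGrz T R E
    by (unfold_locales) (fact assms(1))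
  obtain y where y: "y \<in> U" "(x, y) \<in> Q" "\<And>z. z \<in> U \<Longrightarrow> (y, z) \<in> Q \<Longrightarrow> (z, y) \<in> Q"
    using compact_quasi_max_exists[OF compact _ refl_on_Q trans_Q Q_closed assms(3)] assms(2)
    unfolding clopenin_def by blast
  obtain m where m: "(y, m) \<in> R" "m \<in> max_rel R U"
    using max_rel_exists[OF assms(2) y(1)] by blast
  have E: "(y, z) \<in> E" if "z \<in> U" "(y, z) \<in> Q" for z
    using Q_quasi_max_imp_E[OF assms(2) y(1)] y(3) that by blast
  have "(y, m) \<in> E"
    using E m R_imp_Q unfolding max_rel_def by blast
  \<comment> \<open>Whatever is \<open>Q\<close>-above \<open>m\<close> is \<open>Q\<close>-above
    \<open>y\<close>, so within \<open>U\<close> it lies in the class of \<open>y\<close>, which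
    contains \<open>m\<close>.\<close>
  then have "(m, z) \<in> E" if "z \<in> U" "(m, z) \<in> Q" for z
    using E R_Q m(1) that E_sym E_trans by meson
  then have "m \<in> smax_rel R E U"
    using m(2) unfolding smax_rel_def by blast
  moreover have "(x, m) \<in> Q"
    using y(2) m(1) R_imp_Q trans_Q unfolding trans_def by blast
  ultimately show ?thesis
    by blast
qed

end
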